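(* Let $\lambda>0$ and consider the type II AWGN wiretap channel AWGN-WT($\lambda$) described in the context. Let $\{\mathcal{C}_1(n)\}$ be a good binary linear code sequence of rate $R_1$ whose SNR threshold for binary-input AWGN channels is $\lambda^{\star}$, and let $\mathcal{C}_0(n)=\{0,1\}^n$. Suppose the secure nested code sequence $\{\mathcal{C}_0(n),\mathcal{C}_1(n)\}$ is used over AWGN-WT($\lambda$). If $\lambda\ge\lambda^{\star}$, then the rate-equivocation pair $$(R,R_e)=\bigl(1-R_1,\;1-C_{\rm BI\text{-}AWGN}(\lambda)\bigr)$$ is achievable.
   Context: Type II AWGN wiretap channel AWGN-WT($\lambda$): the transmitter sends a binary sequence $\mathbf{x}\in\{0,1\}^n$ (symbols mapped to $\pm1$); the main channel to the legitimate receiver is noiseless ($\mathbf{y}=\mathbf{x}$); the eavesdropper channel is memoryless binary-input AWGN with output densities $g(z|X=1)=\frac{1}{\sqrt{2\pi}}\exp[-(z+\sqrt{2\lambda})^2/2]$ and $g(z|X=-1)=\frac{1}{\sqrt{2\pi}}\exp[-(z-\sqrt{2\lambda})^2/2]$; $\lambda$ is the eavesdropper SNR. Its capacity is $C_{\rm BI\text{-}AWGN}(\lambda)=1-\frac{1}{\sqrt{\pi}}\int_{-\infty}^{\infty}e^{-(y-\sqrt{\lambda})^2}\log_2(1+e^{-4y\sqrt{\lambda}})\,dy$. A binary linear code sequence $\{\mathcal{C}(n)\}$ consists of $(n,k_n)$ binary linear codes with common rate $R_c=k_n/n$. It is good if it achieves arbitrarily small word error probability over a noisy channel at nonzero rate.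 For a channel family described by a single parameter, the noise threshold of the sequence is the worst-case channel parameter value at which the word error probability (under maximum-likelihood decoding) tends to zero as $n\to\infty$; for BI-AWGN channels this is the SNR threshold $\lambda^\star$ (error probability tends to zero for every SNR $\ge\lambda^\star$). Secure nested code sequence: $\mathcal{C}_1(n)\subseteq\mathcal{C}_0(n)$ linear codes of rates $R_1\le R_0$; the cosets of $\mathcal{C}_1(n)$ in $\mathcal{C}_0(n)$ are indexed by messages $w\in\mathcal{W}=\{1,\dots,M\}$, $M=2^{n(R_0-R_1)}$; message $W$ (uniform) is encoded by choosing a codeword uniformly at random from coset $\mathcal{C}_w(n)$; the legitimate receiver recovers $w$ as the coset of the received word. Information rate is $R_0-R_1$. A pair $(R,R_e)$ is achievable if there is a rate-$R$ code sequence with average error probability at the legitimate receiver tending to $0$ as $n\to\infty$ and $R_e\le\lim_{n\to\infty}H(W|\mathbf{Z})/n$, where $\mathbf{Z}$ is the eavesdropper's output. *)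

theory Defs
  imports "HOL-Probability.Probability"
begin

definition bwords :: "nat \<Rightarrow> bool list set" where
  "bwords n = {xs. length xs = n}"

definition bxor :: "bool list \<Rightarrow> bool list \<Rightarrow> bool list" where
  "bxor xs ys = map2 (\<noteq>) xs ys"

definition linear_code :: "nat \<Rightarrow> bool list set \<Rightarrow> bool" where
  "linear_code n C \<longleftrightarrow> C \<subseteq> bwords n \<and> replicate n False \<in> C \<and>
     (\<forall>x\<in>C. \<forall>y\<in>C. bxor x y \<in> C)"

definition linear_code_seq :: "(nat \<Rightarrow> nat) \<Rightarrow> (nat \<Rightarrow> bool list set) \<Rightarrow> real \<Rightarrow> bool" where
  "linear_code_seq L C R \<longleftrightarrow> strict_mono L \<and>
     (\<forall>m. linear_code (L m) (C m) \<and>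
          (\<exists>k. card (C m) = 2 ^ k \<and> real k / real (L m) = R))"

definition bpsk :: "bool \<Rightarrow> real" where
  "bpsk b = (if b then 1 else -1)"

definition awgn_dens :: "real \<Rightarrow> bool \<Rightarrow> real \<Rightarrow> real" where
  "awgn_dens snr b z = 1 / sqrt (2 * pi) * exp (- ((z + bpsk b * sqrt (2 * snr))\<^sup>2) / 2)"

definition out_space :: "nat \<Rightarrow> (nat \<Rightarrow> real) measure" where
  "out_space n = PiM {..<n} (\<lambda>_. lborel)"

definition lik :: "real \<Rightarrow> bool list \<Rightarrow> (nat \<Rightarrow> real) \<Rightarrow> real" where
  "lik snr x z = (\<Prod>i<length x. awgn_dens snr (x ! i) (z i))"

definition channel_out :: "real \<Rightarrow> bool list \<Rightarrow> (nat \<Rightarrow> real) measure" where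
  "channel_out snr x = density (out_space (length x)) (\<lambda>z. ennreal (lik snr x z))"

text \<open>Word error probability of a code C of length n under ML decoding over BI-AWGN(snr),
  averaged over uniformly chosen codewords. An output z is decoded wrongly when some other
  codeword has likelihood at least that of the transmitted one (ties counted as errors;
  they have probability zero).\<close>

definition ml_word_error :: "nat \<Rightarrow> bool list set \<Rightarrow> real \<Rightarrow> real" where
  "ml_word_error n C snr = (1 / real (card C)) *
     (\<Sum>x\<in>C. measure (channel_out snr x)
        {z \<in> space (out_space n). \<exists>x'\<in>C. x' \<noteq> x \<and> lik snr x' z \<ge> lik snr x z})"

definition good_code_seq :: "(nat \<Rightarrow> nat) \<Rightarrow> (nat \<Rightarrow> bool list set) \<Rightarrow> real \<Rightarrow> bool" where
  "good_code_seq L C R \<longleftrightarrow> linear_code_seq L C R \<and> R > 0 \<and>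
     (\<exists>snr>0. (\<lambda>m. ml_word_error (L m) (C m) snr) \<longlonglongrightarrow> 0)"

definition snr_threshold :: "(nat \<Rightarrow> nat) \<Rightarrow> (nat \<Rightarrow> bool list set) \<Rightarrow> real \<Rightarrow> bool" where
  "snr_threshold L C snrs \<longleftrightarrow>
     (\<forall>snr. snr > 0 \<and> snr \<ge> snrs \<longrightarrow> (\<lambda>m. ml_word_error (L m) (C m) snr) \<longlonglongrightarrow> 0) \<and>
     (\<forall>snr. snr > 0 \<and> snr < snrs \<longrightarrow> \<not> (\<lambda>m. ml_word_error (L m) (C m) snr) \<longlonglongrightarrow> 0)"

definition C_BIAWGN :: "real \<Rightarrow> real" where
  "C_BIAWGN snr = 1 - 1 / sqrt pi *
     (\<integral>y. exp (- ((y - sqrt snr)\<^sup>2)) * log 2 (1 + exp (- 4 * y * sqrt snr)) \<partial>lborel)"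

text \<open>Messages are the cosets of C1 in C0 (a relabelling of {1..M}).\<close>

definition coset_of :: "bool list set \<Rightarrow> bool list \<Rightarrow> bool list set" where
  "coset_of C1 v = bxor v ` C1"

definition messages :: "bool list set \<Rightarrow> bool list set \<Rightarrow> bool list set set" where
  "messages C0 C1 = coset_of C1 ` C0"

definition wt_space :: "nat \<Rightarrow> bool list set \<Rightarrow> bool list set \<Rightarrow>
    (bool list set \<times> bool list \<times> (nat \<Rightarrow> real)) measure" where
  "wt_space n C0 C1 = count_space (messages C0 C1) \<Otimes>\<^sub>M (count_space (bwords n) \<Otimes>\<^sub>M out_space n)"

definition wt_joint :: "real \<Rightarrow> nat \<Rightarrow> bool list set \<Rightarrow> bool list set \<Rightarrow>
    (bool list set \<times> bool list \<times> (nat \<Rightarrow> real)) measure" where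
  "wt_joint snr n C0 C1 = density (wt_space n C0 C1)
     (\<lambda>(w, x, z).  ennreal ((1 / real (card (messages C0 C1))) *
        (if x \<in> w then 1 / real (card w) else 0) * lik snr x z))"

definition equivocation :: "real \<Rightarrow> nat \<Rightarrow> bool list set \<Rightarrow> bool list set \<Rightarrow> real" where
  "equivocation snr n C0 C1 = prob_space.conditional_entropy (wt_joint snr n C0 C1) 2
     (count_space (messages C0 C1)) (out_space n) fst (\<lambda>(w, x, z).  z)"

text \<open>Average error probability of the legitimate receiver, who observes Y = X over the
  noiseless main channel and decodes the coset of the received word.\<close>

definition legit_error :: "bool list set \<Rightarrow> bool list set \<Rightarrow> real" where
  "legit_error C0 C1 = (1 / real (card (messages C0 C1))) *
     (\<Sum>w\<in>messages C0 C1. (1 / real (card w)) *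
        real (card {x\<in>w. coset_of C1 x \<noteq> w}))"

definition nested_achieves :: "real \<Rightarrow> (nat \<Rightarrow> nat) \<Rightarrow> (nat \<Rightarrow> bool list set) \<Rightarrow>
    (nat \<Rightarrow> bool list set) \<Rightarrow> real \<Rightarrow> real \<Rightarrow> bool" where
  "nested_achieves snr L C0 C1 R Req \<longleftrightarrow>
     (\<forall>m. log 2 (real (card (messages (C0 m) (C1 m)))) / real (L m) = R) \<and>
     (\<lambda>m. legit_error (C0 m) (C1 m)) \<longlonglongrightarrow> 0 \<and>
     convergent (\<lambda>m. equivocation snr (L m) (C0 m) (C1 m) / real (L m)) \<and>
     Req \<le> lim (\<lambda>m. equivocation snr (L m) (C0 m) (C1 m) / real (L m))"

end

theory Submission
  imports Defs
begin

text \<open>A uniformly chosen coset followed by a uniform choice inside it makes the channel input \<open>X\<close>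
  uniform on all binary words, so \<open>H(X|Z)\<close> is exactly \<open>n\<close> times the single-letter equivocation
  \<open>1 - C\<close>. As \<open>W\<close> is a function of \<open>X\<close>, \<open>H(W|Z) = H(X|Z) - H(X|W,Z)\<close>. Given \<open>W\<close>, the eavesdropper
  faces a coset of the good code; flipping the signs of outputs turns it into the code itself, so its
  maximum-likelihood error probability is that of the code, and Fano's inequality gives
  \<open>H(X|W,Z) \<le> 1 + n R\<^sub>1 P\<^sub>e = o(n)\<close>.\<close>

section \<open>Binary words and cosets\<close>

text \<open>The limit of the normalised equivocation has to exist, so a lower bound alone would not
  do. Non-negativity of \<open>H(X|W,Z)\<close> supplies the matching upper bound, and the two meet
  because \<open>H(X|Z)\<close> is exact at every block length: with all words allowed as inputs,
  the output of a uniform word has a product law. Message and codeword are discrete while the output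
  is continuous. Only \<open>H(W|Z)\<close> is treated as an entropy of the joint measure, through
  densities of \<open>(W,Z)\<close> and \<open>Z\<close>. The two entropies of \<open>X\<close>
  appear as integrals of a likelihood times the logarithm of an inverse posterior,
  \<open>log 2 (code_lik snr W z / lik snr x z)\<close>, where \<open>W\<close> is a coset or the
  set of all words. In this form the chain rule is an identity between integrands, and Fano's
  inequality can be applied at each fixed output \<open>z\<close> before integrating.\<close>

lemma finite_bwords [simp]: "finite (bwords n)"
  using finite_lists_length_eq[of "UNIV :: bool set" n] by (simp add: bwords_def)

lemma card_bwords: "card (bwords n) = 2 ^ n"
  using card_lists_length_eq[of "UNIV :: bool set" n] by (simp add: bwords_def)

lemma bxor_in_bwords: "x \<in> bwords n \<Longrightarrow> y \<in> bwords n \<Longrightarrow> bxor x y \<in> bwords n"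
  by (simp add: bwords_def bxor_def)

lemma bxor_nth:
  "x \<in> bwords n \<Longrightarrow> y \<in> bwords n \<Longrightarrow> i < n \<Longrightarrow> bxor x y ! i \<longleftrightarrow> x ! i \<noteq> y ! i"
  by (simp add: bwords_def bxor_def)

lemma bwords_eqI:
  "x \<in> bwords n \<Longrightarrow> y \<in> bwords n \<Longrightarrow> (\<And>i. i < n \<Longrightarrow> x ! i \<longleftrightarrow> y ! i) \<Longrightarrow> x = y"
  by (auto simp: bwords_def intro: nth_equalityI)

lemma bxor_assoc:
  assumes "x \<in> bwords n" "y \<in> bwords n" "z \<in> bwords n"
  shows "bxor (bxor x y) z = bxor x (bxor y z)"
  by (rule bwords_eqI[of _ n]) (use assms in \<open>auto simp: bxor_nth[of _ n] bxor_in_bwords\<close>)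

lemma bxor_cancel_left:
  assumes "x \<in> bwords n" "y \<in> bwords n"
  shows "bxor x (bxor x y) = y"
  by (rule bwords_eqI[of _ n]) (use assms in \<open>auto simp: bxor_nth[of _ n] bxor_in_bwords\<close>)

lemma bxor_zero_right:
  assumes "x \<in> bwords n"
  shows "bxor x (replicate n False) = x"
proof -
  have "replicate n False \<in> bwords n" by (simp add: bwords_def)
  with assms show ?thesis
    by (intro bwords_eqI[of _ n]) (auto simp: bxor_nth[of _ n] bxor_in_bwords)
qed

lemma inj_on_bxor: "x \<in> bwords n \<Longrightarrow> inj_on (bxor x) (bwords n)"
  by (metis bxor_cancel_left inj_onI)

section \<open>The partition of the binary words into cosets of a linear code\<close>

locale binary_linear_code =
  fixes n :: nat and C :: "bool list set"
  assumes linear: "linear_code n C"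
begin

abbreviation "cosets \<equiv> messages (bwords n) C"

lemma code_subset: "C \<subseteq> bwords n"
  and zero_in_code: "replicate n False \<in> C"
  and bxor_in_code: "x \<in> C \<Longrightarrow> y \<in> C \<Longrightarrow> bxor x y \<in> C"
  using linear by (auto simp: linear_code_def)

lemma finite_code: "finite C"
  using code_subset finite_subset finite_bwords by blast

lemma card_code_pos: "card C > 0"
  using finite_code zero_in_code card_gt_0_iff by blast

lemma coset_subset: "v \<in> bwords n \<Longrightarrow> coset_of C v \<subseteq> bwords n"
  using code_subset bxor_in_bwords by (auto simp: coset_of_def)

lemma mem_coset_self: "v \<in> bwords n \<Longrightarrow> v \<in> coset_of C v"
  using zero_in_code bxor_zero_right by (force simp: coset_of_def)

text \<open>If \<open>x\<close> is \<open>v\<close> shifted by a codeword \<open>c\<close>, then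
  shifting by \<open>c\<close> permutes the code and is its own inverse, so it translates a
  representation based at \<open>x\<close> into one based at \<open>v\<close> and back. Facts 1 and
  2 are the two directions.\<close>

lemma coset_of_mem:
  assumes v: "v \<in> bwords n" and x: "x \<in> coset_of C v"
  shows "coset_of C x = coset_of C v"
proof -
  obtain c where c: "c \<in> C" "x = bxor v c"
    using x by (auto simp: coset_of_def)
  have cn: "c \<in> bwords n" using c code_subset by auto
  have 1: "bxor x d = bxor v (bxor c d)" if "d \<in> C" for d
    using bxor_assoc[OF v cn, of d] that code_subset c by auto
  have 2: "bxor v d = bxor x (bxor c d)" if "d \<in> C" for d
    using bxor_assoc[OF v cn, of "bxor c d"] bxor_cancel_left[OF cn, of d] bxor_in_bwords[OF cn, of d]
      that code_subset c by auto
  show ?thesis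
    unfolding coset_of_def
    by (intro equalityI image_subsetI) (metis 1 2 bxor_in_code c(1) imageI)+
qed

text \<open>Being the fibres of \<open>coset_of C\<close>, the cosets partition the words. This one
  fact yields both the regrouping of sums in \<open>sum_cosets\<close> and the error-free decoding
  of the legitimate receiver.\<close>

lemma coset_eq_fibre:
  assumes "w \<in> cosets"
  shows "{x \<in> bwords n. coset_of C x = w} = w"
proof -
  obtain v where v: "v \<in> bwords n" "w = coset_of C v"
    using assms by (auto simp: messages_def)
  show ?thesis
    using v coset_subset[of v] coset_of_mem[of v] mem_coset_self by blast
qed

lemma finite_cosets: "finite cosets"
  by (simp add: messages_def)

lemma coset_in_bwords: "w \<in> cosets \<Longrightarrow> w \<subseteq> bwords n"
  using coset_eq_fibre by blast

lemma finite_coset: "w \<in> cosets \<Longrightarrow> finite w"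
  using coset_in_bwords finite_subset finite_bwords by blast

lemma card_coset:
  assumes "w \<in> cosets" shows "card w = card C"
proof -
  obtain v where v: "v \<in> bwords n" "w = coset_of C v"
    using assms by (auto simp: messages_def)
  then show ?thesis
    using card_image inj_on_subset[OF inj_on_bxor code_subset] by (auto simp: coset_of_def)
qed

lemma sum_cosets: "(\<Sum>w\<in>cosets. \<Sum>x\<in>w. f x) = (\<Sum>x\<in>bwords n. f x)"
  for f :: "bool list \<Rightarrow> 'a :: comm_monoid_add"
proof -
  have "(\<Sum>x\<in>bwords n. f x) = (\<Sum>w\<in>cosets. sum f {x \<in> bwords n. coset_of C x = w})"
    unfolding messages_def by (rule sum.image_gen) simp
  also have "\<dots> = (\<Sum>w\<in>cosets. sum f w)"
    by (intro sum.cong refl) (simp add: coset_eq_fibre)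
  finally show ?thesis by simp
qed

lemma card_cosets: "card cosets * card C = 2 ^ n"
proof -
  have "(\<Sum>w\<in>cosets. \<Sum>x\<in>w. 1 :: nat) = 2 ^ n"
    by (simp only: sum_cosets) (simp add: card_bwords)
  moreover have "(\<Sum>w\<in>cosets. \<Sum>x\<in>w. 1 :: nat) = (\<Sum>w\<in>cosets. card C)"
    by (intro sum.cong refl) (simp add: card_coset)
  ultimately show ?thesis by simp
qed

lemma coset_weight:
  "w \<in> cosets \<Longrightarrow> 1 / real (card cosets) * (1 / real (card w)) = 1 / 2 ^ n"
proof -
  have "real (card cosets) * real (card C) = 2 ^ n"
    using card_cosets by (metis of_nat_mult of_nat_numeral of_nat_power)
  then show "w \<in> cosets \<Longrightarrow> ?thesis" by (simp add: card_coset)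
qed

lemma legit_error_zero: "legit_error (bwords n) C = 0"
proof -
  have "{x \<in> w. coset_of C x \<noteq> w} = {}" if "w \<in> cosets" for w
    using coset_eq_fibre[OF that] by auto
  then have "(\<Sum>w\<in>cosets. 1 / real (card w) * real (card {x \<in> w. coset_of C x \<noteq> w})) = 0"
    by (intro sum.neutral ballI) (simp only: card.empty of_nat_0 mult_zero_right)
  then show ?thesis by (simp only: legit_error_def mult_zero_right)
qed

end

section \<open>Products with a finite counting measure\<close>

lemma nn_integral_count_space_pair:
  assumes "finite A" "sigma_finite_measure M"
    and [measurable]: "f \<in> borel_measurable (count_space A \<Otimes>\<^sub>M M)"
  shows "(\<integral>\<^sup>+p. f p \<partial>(count_space A \<Otimes>\<^sub>M M)) = (\<Sum>a\<in>A. \<integral>\<^sup>+y. f (a, y) \<partial>M)"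
proof -
  interpret sigma_finite_measure M by fact
  have "(\<integral>\<^sup>+p. f p \<partial>(count_space A \<Otimes>\<^sub>M M)) = (\<integral>\<^sup>+a. \<integral>\<^sup>+y. f (a, y) \<partial>M \<partial>count_space A)"
    by (simp add: nn_integral_fst)
  then show ?thesis
    using assms(1) by (simp add: nn_integral_count_space_finite)
qed

text \<open>Integrability on the product comes for free: with finitely many slices, the integral of
  the norm is a finite sum of finite terms, so Fubini applies.\<close>

lemma integral_count_space_pair:
  fixes f :: "'a \<times> 'b \<Rightarrow> real"
  assumes A: "finite A" and M: "sigma_finite_measure M"
    and int: "\<And>a. a \<in> A \<Longrightarrow> integrable M (\<lambda>y. f (a, y))"
  shows "(\<integral>p. f p \<partial>(count_space A \<Otimes>\<^sub>M M)) = (\<Sum>a\<in>A. \<integral>y. f (a, y) \<partial>M)"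
proof -
  interpret pair_sigma_finite "count_space A" M
    by (intro pair_sigma_finite.intro M sigma_finite_measure_count_space_finite A)
  have [measurable]: "f \<in> borel_measurable (count_space A \<Otimes>\<^sub>M M)"
    using A int by (intro measurable_pair_measure_countable1) (auto intro: countable_finite)
  have "(\<integral>\<^sup>+p. norm (f p) \<partial>(count_space A \<Otimes>\<^sub>M M)) = (\<Sum>a\<in>A. \<integral>\<^sup>+y. norm (f (a, y)) \<partial>M)"
    by (rule nn_integral_count_space_pair[OF A M]) simp
  also have "\<dots> < \<infinity>"
    using int A by (auto simp: integrable_iff_bounded)
  finally have "integrable (count_space A \<Otimes>\<^sub>M M) f"
    by (simp add: integrable_iff_bounded)
  then have "(\<integral>p. f p \<partial>(count_space A \<Otimes>\<^sub>M M)) = (\<integral>a. \<integral>y. f (a, y) \<partial>M \<partial>count_space A)"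
    by (simp add: integral_fst')
  then show ?thesis
    using A by (simp add: lebesgue_integral_count_space_finite)
qed

section \<open>The binary-input Gaussian channel\<close>

lemma awgn_dens_eq_normal_density:
  "awgn_dens snr b = normal_density (- bpsk b * sqrt (2 * snr)) 1"
  by (auto simp: awgn_dens_def normal_density_def fun_eq_iff)

lemma awgn_dens_pos: "awgn_dens snr b z > 0"
  by (simp add: awgn_dens_eq_normal_density normal_density_pos)

lemma borel_measurable_awgn_dens [measurable]: "awgn_dens snr b \<in> borel_measurable borel"
  by (simp add: awgn_dens_eq_normal_density)

lemma integrable_awgn_dens: "integrable lborel (awgn_dens snr b)"
  and integral_awgn_dens: "(\<integral>z. awgn_dens snr b z \<partial>lborel) = 1"
  by (simp_all add: awgn_dens_eq_normal_density)

text \<open>For equiprobable inputs this is the logarithm of the inverse posterior of the bit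
  \<open>b\<close> given the output \<open>z\<close>.\<close>

definition awgn_loss :: "real \<Rightarrow> bool \<Rightarrow> real \<Rightarrow> real" where
  "awgn_loss snr b z = log 2 (1 + awgn_dens snr (\<not> b) z / awgn_dens snr b z)"

lemma awgn_dens_ratio:
  "awgn_dens snr (\<not> b) z / awgn_dens snr b z = exp (2 * bpsk b * sqrt (2 * snr) * z)"
proof -
  have "awgn_dens snr (\<not> b) z / awgn_dens snr b z =
    exp (- ((z + bpsk (\<not> b) * sqrt (2 * snr))\<^sup>2) / 2 - (- ((z + bpsk b * sqrt (2 * snr))\<^sup>2) / 2))"
    unfolding awgn_dens_def exp_diff by simp
  also have "- ((z + bpsk (\<not> b) * sqrt (2 * snr))\<^sup>2) / 2 - (- ((z + bpsk b * sqrt (2 * snr))\<^sup>2) / 2)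
      = 2 * bpsk b * sqrt (2 * snr) * z"
    by (simp add: bpsk_def power2_eq_square algebra_simps add_divide_distrib diff_divide_distrib)
  finally show ?thesis .
qed

lemma awgn_loss_eq: "awgn_loss snr b z = log 2 (1 + exp (2 * bpsk b * sqrt (2 * snr) * z))"
  by (simp add: awgn_loss_def awgn_dens_ratio)

lemma borel_measurable_awgn_loss [measurable]: "awgn_loss snr b \<in> borel_measurable borel"
  unfolding awgn_loss_eq[abs_def] by measurable

text \<open>The loss therefore grows at most linearly in the output, so a first absolute Gaussian
  moment is enough to integrate it.\<close>

lemma ln_1_plus_exp_le: "ln (1 + exp u) \<le> ln 2 + \<bar>u\<bar>" for u :: real
proof -
  have "1 + exp u \<le> 2 * exp \<bar>u\<bar>"
    using exp_le_cancel_iff[of u "\<bar>u\<bar>"] one_le_exp_iff[of "\<bar>u\<bar>"] by linarith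
  then have "ln (1 + exp u) \<le> ln (2 * exp \<bar>u\<bar>)"
    by (subst ln_le_cancel_iff) (auto intro: add_pos_pos)
  then show ?thesis by (simp add: ln_mult)
qed

lemma integrable_awgn_loss: "integrable lborel (\<lambda>z. awgn_dens snr b z * awgn_loss snr b z)"
proof -
  define a where "a = 2 * bpsk b * sqrt (2 * snr)"
  define m where "m = - bpsk b * sqrt (2 * snr)"
  \<comment> \<open>\<open>m\<close> is the mean of the density. The output is split as
    \<open>m\<close> plus a deviation because the moment integrated below is centred; its exponent 1
    is written out to match \<open>integrable_normal_moment_abs\<close>.\<close>
  have bound: "norm (awgn_dens snr b z * awgn_loss snr b z) \<le>
      norm (((ln 2 + \<bar>a\<bar> * \<bar>m\<bar>) / ln 2) * normal_density m 1 z +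
        (\<bar>a\<bar> / ln 2) * (normal_density m 1 z * \<bar>z - m\<bar> ^ 1))" for z
  proof -
    have "\<bar>a * z\<bar> \<le> \<bar>a\<bar> * (\<bar>m\<bar> + \<bar>z - m\<bar>)"
      unfolding abs_mult by (rule mult_left_mono) auto
    then have "ln (1 + exp (a * z)) \<le> ln 2 + \<bar>a\<bar> * (\<bar>m\<bar> + \<bar>z - m\<bar>)"
      using ln_1_plus_exp_le[of "a * z"] by linarith
    then have "awgn_loss snr b z \<le> (ln 2 + \<bar>a\<bar> * (\<bar>m\<bar> + \<bar>z - m\<bar>)) / ln 2"
      by (simp add: awgn_loss_eq a_def log_def divide_right_mono)
    then have "normal_density m 1 z * awgn_loss snr b z \<le>
        normal_density m 1 z * ((ln 2 + \<bar>a\<bar> * (\<bar>m\<bar> + \<bar>z - m\<bar>)) / ln 2)"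
      by (intro mult_left_mono) auto
    moreover have "0 \<le> awgn_loss snr b z"
      by (simp add: awgn_loss_eq add_pos_pos)
    ultimately show ?thesis
      unfolding awgn_dens_eq_normal_density m_def[symmetric] by (simp add: field_simps)
  qed
  show ?thesis
  proof (rule Bochner_Integration.integrable_bound[OF _ _ AE_I2[OF bound]])
    show "integrable lborel (\<lambda>z. ((ln 2 + \<bar>a\<bar> * \<bar>m\<bar>) / ln 2) * normal_density m 1 z +
        (\<bar>a\<bar> / ln 2) * (normal_density m 1 z * \<bar>z - m\<bar> ^ 1))"
      by (intro Bochner_Integration.integrable_add integrable_mult_right
          integrable_normal_moment_abs integrable_normal_density) auto
  qed measurable
qed

lemma integral_awgn_loss:
  assumes "snr > 0"
  shows "(\<integral>z. awgn_dens snr b z * awgn_loss snr b z \<partial>lborel) = 1 - C_BIAWGN snr"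
proof -
  \<comment> \<open>Substituting \<open>z = c * y\<close> moves the mean to \<open>sqrt snr\<close>
    and turns unit variance into 1/2, the scaling in which \<open>C_BIAWGN\<close> is written. The
    sign in \<open>c\<close> makes both input symbols lead to the same integral.\<close>
  define c where "c = - bpsk b * sqrt 2"
  have c: "c \<noteq> 0" "\<bar>c\<bar> = sqrt 2" "c\<^sup>2 = 2" "bpsk b * bpsk b = 1"
    by (auto simp: c_def bpsk_def)
  have "(\<integral>z. awgn_dens snr b z * awgn_loss snr b z \<partial>lborel) =
      sqrt 2 * (\<integral>y. awgn_dens snr b (c * y) * awgn_loss snr b (c * y) \<partial>lborel)"
    using lborel_integral_real_affine[OF c(1), of "\<lambda>z. awgn_dens snr b z * awgn_loss snr b z" 0] c(2)
    by simp
  also have "\<dots> = sqrt 2 * (\<integral>y. 1 / sqrt (2 * pi) * (exp (- ((y - sqrt snr)\<^sup>2)) *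
      log 2 (1 + exp (- 4 * y * sqrt snr))) \<partial>lborel)"
  proof -
    have square: "(c * y + bpsk b * sqrt (2 * snr))\<^sup>2 = 2 * (y - sqrt snr)\<^sup>2" for y
    proof -
      have "c * y + bpsk b * sqrt (2 * snr) = c * (y - sqrt snr)"
        by (simp add: c_def real_sqrt_mult algebra_simps)
      then show ?thesis by (simp add: power_mult_distrib c)
    qed
    have slope: "2 * bpsk b * sqrt (2 * snr) * (c * y) = - 4 * y * sqrt snr" for y
    proof -
      have "2 * bpsk b * sqrt (2 * snr) * (c * y) =
          - 2 * (bpsk b * bpsk b) * (sqrt 2 * sqrt 2) * sqrt snr * y"
        by (simp only: c_def real_sqrt_mult) (simp add: algebra_simps)
      then show ?thesis using c(4) by simp
    qed
    show ?thesis
      unfolding awgn_loss_eq awgn_dens_def square slope by simp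
  qed
  also have "\<dots> = 1 - C_BIAWGN snr"
    by (simp add: C_BIAWGN_def real_sqrt_mult)
  finally show ?thesis .
qed

section \<open>The memoryless channel\<close>

lemma product_sigma_finite_lborel: "product_sigma_finite (\<lambda>_. lborel :: real measure)"
  by standard

lemma sigma_finite_out_space: "sigma_finite_measure (out_space n)"
  unfolding out_space_def
  by (rule product_sigma_finite.sigma_finite[OF product_sigma_finite_lborel]) simp

lemma measurable_out_space_component [measurable]:
  "i < n \<Longrightarrow> (\<lambda>z. z i) \<in> borel_measurable (out_space n)"
  unfolding out_space_def using measurable_component_singleton[of i "{..<n}" "\<lambda>_. lborel"] by simp

lemma lik_pos: "lik snr x z > 0"
  by (simp add: lik_def prod_pos awgn_dens_pos)

lemma lik_bwords: "x \<in> bwords n \<Longrightarrow> lik snr x z = (\<Prod>i<n. awgn_dens snr (x ! i) (z i))"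
  by (simp add: lik_def bwords_def)

lemma borel_measurable_lik [simp]:
  "x \<in> bwords n \<Longrightarrow> lik snr x \<in> borel_measurable (out_space n)"
  unfolding lik_def[abs_def] bwords_def by (auto intro!: borel_measurable_prod)

lemma
  fixes f :: "real \<Rightarrow> real"
  assumes x: "x \<in> bwords n" and i: "i < n"
    and f: "integrable lborel (\<lambda>t. awgn_dens snr (x ! i) t * f t)"
  shows integrable_lik_component: "integrable (out_space n) (\<lambda>z. lik snr x z * f (z i))"
    and integral_lik_component:
      "(\<integral>z. lik snr x z * f (z i) \<partial>out_space n) = (\<integral>t. awgn_dens snr (x ! i) t * f t \<partial>lborel)"
proof -
  define h where "h j t = awgn_dens snr (x ! j) t * (if j = i then f t else 1)" for j t
  have eq: "lik snr x z * f (z i) = (\<Prod>j<n. h j (z j))" for z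
    using i by (simp add: lik_bwords[OF x] h_def prod.distrib prod.delta)
  have int: "integrable lborel (h j)" for j
    using f integrable_awgn_dens[of snr "x ! j"] by (cases "j = i") (auto simp: h_def[abs_def])
  show "integrable (out_space n) (\<lambda>z. lik snr x z * f (z i))"
    unfolding eq out_space_def
    by (intro product_sigma_finite.product_integrable_prod[OF product_sigma_finite_lborel] int) simp
  have "(\<integral>z. lik snr x z * f (z i) \<partial>out_space n) = (\<Prod>j<n. integral\<^sup>L lborel (h j))"
    unfolding eq out_space_def
    by (intro product_sigma_finite.product_integral_prod[OF product_sigma_finite_lborel] int) simp
  also have "\<dots> = (\<Prod>j<n. if j = i then integral\<^sup>L lborel (h i) else 1)"
    by (intro prod.cong refl) (auto simp: h_def[abs_def] integral_awgn_dens)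
  also have "\<dots> = (\<integral>t. awgn_dens snr (x ! i) t * f t \<partial>lborel)"
    using i by (simp add: prod.delta) (simp add: h_def[abs_def])
  finally show "(\<integral>z. lik snr x z * f (z i) \<partial>out_space n) =
    (\<integral>t. awgn_dens snr (x ! i) t * f t \<partial>lborel)" .
qed

lemma
  assumes x: "x \<in> bwords n"
  shows integrable_lik: "integrable (out_space n) (lik snr x)"
    and integral_lik: "(\<integral>z. lik snr x z \<partial>out_space n) = 1"
proof -
  show "integrable (out_space n) (lik snr x)"
    unfolding lik_bwords[OF x, THEN ext] out_space_def
    by (intro product_sigma_finite.product_integrable_prod[OF product_sigma_finite_lborel]
        integrable_awgn_dens) simp
  have "(\<integral>z. lik snr x z \<partial>out_space n) = (\<Prod>j<n. integral\<^sup>L lborel (awgn_dens snr (x ! j)))"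
    unfolding lik_bwords[OF x] out_space_def
    by (intro product_sigma_finite.product_integral_prod[OF product_sigma_finite_lborel]
        integrable_awgn_dens) simp
  then show "(\<integral>z. lik snr x z \<partial>out_space n) = 1"
    by (simp add: integral_awgn_dens)
qed

text \<open>Distributivity: expanding the product picks one bit per position, hence one term per
  word. Up to normalisation, it says that uniform inputs produce independent outputs.\<close>

lemma sum_lik_bwords:
  "(\<Sum>x\<in>bwords n. lik snr x z) = (\<Prod>i<n. awgn_dens snr True (z i) + awgn_dens snr False (z i))"
proof (induction n)
  case 0
  have "bwords 0 = {[]}" by (auto simp: bwords_def)
  then show ?case by (simp add: lik_def)
next
  case (Suc n)
  \<comment> \<open>Words grow at the end, not at the front, so that the first \<open>n\<close>
    positions keep their indices and their outputs.\<close>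
  have inj: "inj_on (\<lambda>(x, b). x @ [b]) (bwords n \<times> UNIV)"
    by (auto simp: inj_on_def)
  have img: "bwords (Suc n) = (\<lambda>(x, b). x @ [b]) ` (bwords n \<times> UNIV)"
  proof (intro equalityI subsetI)
    fix y :: "bool list" assume "y \<in> bwords (Suc n)"
    then have "length y = Suc n" by (simp add: bwords_def)
    then have "y = butlast y @ [last y]" "butlast y \<in> bwords n"
      by (auto simp: bwords_def intro!: append_butlast_last_id[symmetric])
    then show "y \<in> (\<lambda>(x, b). x @ [b]) ` (bwords n \<times> UNIV)" by force
  qed (auto simp: bwords_def)
  have snoc: "lik snr (x @ [b]) z = lik snr x z * awgn_dens snr b (z n)" if "x \<in> bwords n" for x b
    using that by (auto simp: lik_def bwords_def nth_append intro!: prod.cong)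
  have "(\<Sum>x\<in>bwords (Suc n). lik snr x z) =
      (\<Sum>(x, b)\<in>bwords n \<times> UNIV. lik snr x z * awgn_dens snr b (z n))"
    unfolding img by (subst sum.reindex[OF inj]) (auto simp: snoc intro!: sum.cong)
  also have "\<dots> = (\<Sum>x\<in>bwords n. lik snr x z) * (\<Sum>b\<in>UNIV. awgn_dens snr b (z n))"
    by (simp add: sum.cartesian_product[symmetric] sum_product)
  finally show ?case
    by (simp add: Suc.IH UNIV_bool add.commute)
qed

text \<open>Numerator and denominator both factor over positions, so the logarithm of the inverse
  posterior is additive. This is why \<open>H(X|Z)\<close> needs no asymptotic estimate.\<close>

lemma log_posterior_sum:
  assumes x: "x \<in> bwords n"
  shows "log 2 ((\<Sum>y\<in>bwords n. lik snr y z) / lik snr x z) = (\<Sum>i<n. awgn_loss snr (x ! i) (z i))"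
proof -
  have "(\<Sum>y\<in>bwords n. lik snr y z) / lik snr x z =
      (\<Prod>i<n. 1 + awgn_dens snr (\<not> x ! i) (z i) / awgn_dens snr (x ! i) (z i))"
    unfolding sum_lik_bwords lik_bwords[OF x] prod_dividef[symmetric]
  proof (intro prod.cong refl)
    fix i
    show "(awgn_dens snr True (z i) + awgn_dens snr False (z i)) / awgn_dens snr (x ! i) (z i) =
        1 + awgn_dens snr (\<not> x ! i) (z i) / awgn_dens snr (x ! i) (z i)"
      using awgn_dens_pos[of snr _ "z i"] by (cases "x ! i") (auto simp: add_divide_distrib less_imp_neq[symmetric])
  qed
  moreover have "0 < 1 + awgn_dens snr (\<not> x ! i) (z i) / awgn_dens snr (x ! i) (z i)" for i
    by (intro add_pos_pos divide_pos_pos awgn_dens_pos) simp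
  note less_imp_neq[OF this, symmetric]
  ultimately show ?thesis
    unfolding awgn_loss_def log_def sum_divide_distrib[symmetric] by (subst ln_prod[symmetric]) auto
qed

lemma
  assumes "snr > 0" and x: "x \<in> bwords n"
  shows integrable_lik_log_posterior: "integrable (out_space n)
      (\<lambda>z. lik snr x z * log 2 ((\<Sum>y\<in>bwords n. lik snr y z) / lik snr x z))"
    and integral_lik_log_posterior:
      "(\<integral>z. lik snr x z * log 2 ((\<Sum>y\<in>bwords n. lik snr y z) / lik snr x z) \<partial>out_space n) =
        real n * (1 - C_BIAWGN snr)"
proof -
  have int: "integrable (out_space n) (\<lambda>z. lik snr x z * awgn_loss snr (x ! i) (z i))" if "i < n" for i
    by (rule integrable_lik_component[OF x that integrable_awgn_loss])
  then show "integrable (out_space n)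
      (\<lambda>z. lik snr x z * log 2 ((\<Sum>y\<in>bwords n. lik snr y z) / lik snr x z))"
    unfolding log_posterior_sum[OF x] sum_distrib_left by (intro Bochner_Integration.integrable_sum) simp
  have "(\<integral>z. lik snr x z * log 2 ((\<Sum>y\<in>bwords n. lik snr y z) / lik snr x z) \<partial>out_space n) =
      (\<Sum>i<n. \<integral>z. lik snr x z * awgn_loss snr (x ! i) (z i) \<partial>out_space n)"
    unfolding log_posterior_sum[OF x] sum_distrib_left using int
    by (intro Bochner_Integration.integral_sum) simp
  also have "\<dots> = (\<Sum>i<n. 1 - C_BIAWGN snr)"
    by (intro sum.cong refl)
      (simp add: integral_lik_component[OF x _ integrable_awgn_loss] integral_awgn_loss[OF assms(1)])
  finally show "(\<integral>z. lik snr x z * log 2 ((\<Sum>y\<in>bwords n. lik snr y z) / lik snr x z) \<partial>out_space n) =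
        real n * (1 - C_BIAWGN snr)" by simp
qed

section \<open>Sign flips\<close>

text \<open>The restriction to \<open>{..<n}\<close> keeps the result in
  \<open>space (out_space n)\<close>, whose elements are extensional functions.\<close>

definition flip :: "nat \<Rightarrow> bool list \<Rightarrow> (nat \<Rightarrow> real) \<Rightarrow> nat \<Rightarrow> real" where
  "flip n v z = (\<lambda>i\<in>{..<n}. if v ! i then - z i else z i)"

lemma measurable_flip [measurable]: "flip n v \<in> out_space n \<rightarrow>\<^sub>M out_space n"
  unfolding flip_def[abs_def] out_space_def
proof (rule measurable_restrict)
  fix i assume "i \<in> {..<n}"
  then have "(\<lambda>z. z i) \<in> borel_measurable (PiM {..<n} (\<lambda>_. lborel :: real measure))"
    using measurable_component_singleton[of i "{..<n}" "\<lambda>_. lborel :: real measure"] by simp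
  then show "(\<lambda>z. if v ! i then - z i else z i) \<in> PiM {..<n} (\<lambda>_. lborel) \<rightarrow>\<^sub>M (lborel :: real measure)"
    by (cases "v ! i") simp_all
qed

lemma distr_flip: "distr (out_space n) (out_space n) (flip n v) = out_space n"
proof -
  interpret product_sigma_finite "\<lambda>_. lborel :: real measure" by (rule product_sigma_finite_lborel)
  have "distr (out_space n) (out_space n) (flip n v) = PiM {..<n} (\<lambda>_. lborel)"
  proof (rule PiM_eqI)
    fix A :: "nat \<Rightarrow> real set" assume A: "\<And>i. i \<in> {..<n} \<Longrightarrow> A i \<in> sets lborel"
    \<comment> \<open>A box is pulled back to a box whose flipped sides are mirrored, and Lebesgue
      measure on the line is invariant under reflection. Boxes determine the product
      measure.\<close>
    define B where "B i = (if v ! i then uminus -` A i else A i)" for i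
    have B: "B i \<in> sets lborel" if "i < n" for i
      using A[of i] that measurable_sets[of uminus borel borel "A i"] by (auto simp: B_def)
    have emB: "emeasure lborel (B i) = emeasure lborel (A i)" if "i < n" for i
    proof -
      have "emeasure lborel (A i) = emeasure (distr lborel borel uminus) (A i)"
        by (simp add: lborel_distr_uminus)
      also have "\<dots> = emeasure lborel (uminus -` A i)"
        using A[of i] that by (subst emeasure_distr) auto
      finally show ?thesis by (simp add: B_def)
    qed
    have "emeasure (distr (out_space n) (out_space n) (flip n v)) (Pi\<^sub>E {..<n} A) =
        emeasure (out_space n) (flip n v -` Pi\<^sub>E {..<n} A \<inter> space (out_space n))"
      using A by (intro emeasure_distr measurable_flip) (auto simp: out_space_def intro!: sets_PiM_I_finite)
    also have "flip n v -` Pi\<^sub>E {..<n} A \<inter> space (out_space n) = Pi\<^sub>E {..<n} B"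
    proof (rule set_eqI)
      fix z
      have "flip n v z \<in> Pi\<^sub>E {..<n} A \<longleftrightarrow> (\<forall>i\<in>{..<n}. z i \<in> B i)"
        unfolding flip_def restrict_PiE_iff by (rule ball_cong) (simp_all add: B_def)
      then show "z \<in> flip n v -` Pi\<^sub>E {..<n} A \<inter> space (out_space n) \<longleftrightarrow> z \<in> Pi\<^sub>E {..<n} B"
        by (simp add: out_space_def space_PiM PiE_iff)
    qed
    also have "emeasure (out_space n) (Pi\<^sub>E {..<n} B) = (\<Prod>i<n. emeasure lborel (A i))"
      unfolding out_space_def using B emB by (subst emeasure_PiM) auto
    finally show "emeasure (distr (out_space n) (out_space n) (flip n v)) (Pi\<^sub>E {..<n} A) =
      (\<Prod>i<n. emeasure lborel (A i))" .
  qed (auto simp: out_space_def)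
  then show ?thesis by (simp add: out_space_def)
qed

text \<open>The channel is output-symmetric: inverting an input bit mirrors its Gaussian about
  0.\<close>

lemma lik_bxor:
  assumes "v \<in> bwords n" "x \<in> bwords n"
  shows "lik snr (bxor v x) z = lik snr x (flip n v z)"
proof -
  have "awgn_dens snr (\<not> b) t = awgn_dens snr b (- t)" for b t
    by (cases b) (simp_all add: awgn_dens_def bpsk_def power2_eq_square algebra_simps)
  then have "awgn_dens snr (bxor v x ! i) (z i) = awgn_dens snr (x ! i) (flip n v z i)" if "i < n" for i
    using bxor_nth[OF assms that] that by (cases "v ! i") (auto simp: flip_def)
  then show ?thesis
    using assms by (simp add: lik_bwords[of _ n] bxor_in_bwords)
qed

text \<open>The event inside \<open>ml_word_error\<close>, with the candidate set left free: once
  the message is known, the search runs over a coset, which need not be a linear code.\<close>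

definition ml_error_event :: "real \<Rightarrow> bool list set \<Rightarrow> bool list \<Rightarrow> (nat \<Rightarrow> real) \<Rightarrow> bool" where
  "ml_error_event snr W x z \<longleftrightarrow> (\<exists>x'\<in>W. x' \<noteq> x \<and> lik snr x' z \<ge> lik snr x z)"

lemma measurable_ml_error_event [simp]:
  assumes "W \<subseteq> bwords n" "x \<in> bwords n"
  shows "Measurable.pred (out_space n) (ml_error_event snr W x)"
proof -
  have [measurable]: "lik snr x \<in> borel_measurable (out_space n)"
    using assms by simp
  have "finite W" using assms(1) finite_subset finite_bwords by blast
  moreover have "Measurable.pred (out_space n) (\<lambda>z. x' \<noteq> x \<and> lik snr x' z \<ge> lik snr x z)" if "x' \<in> W" for x'
  proof -
    have [measurable]: "lik snr x' \<in> borel_measurable (out_space n)"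
      using assms that by auto
    have "{z \<in> space (out_space n). lik snr x z \<le> lik snr x' z} \<in> sets (out_space n)"
      by (rule borel_measurable_le) measurable
    then show ?thesis by (cases "x' = x") (simp_all add: pred_def)
  qed
  ultimately show ?thesis
    unfolding ml_error_event_def[abs_def] by (intro pred_intros_finite)
qed

lemma measure_channel_out:
  assumes x: "x \<in> bwords n" and [measurable]: "Measurable.pred (out_space n) P"
  shows "measure (channel_out snr x) {z \<in> space (out_space n). P z} =
    (\<integral>z. lik snr x z * of_bool (P z) \<partial>out_space n)"
proof -
  have [measurable]: "lik snr x \<in> borel_measurable (out_space n)" using x by simp
  have len: "length x = n" using x by (simp add: bwords_def)
  have "emeasure (channel_out snr x) {z \<in> space (out_space n). P z} =
      (\<integral>\<^sup>+z. ennreal (lik snr x z) * indicator {z \<in> space (out_space n). P z} z \<partial>out_space n)"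
    unfolding channel_out_def len by (rule emeasure_density) measurable
  also have "\<dots> = (\<integral>\<^sup>+z. ennreal (lik snr x z * of_bool (P z)) \<partial>out_space n)"
    by (intro nn_integral_cong) (simp add: indicator_def)
  finally show ?thesis
    by (simp add: measure_def integral_eq_nn_integral less_imp_le[OF lik_pos])
qed

text \<open>The change of variables \<open>flip n v\<close> preserves the base measure and turns
  every likelihood in the coset into one in the code. Since \<open>bxor v\<close> is injective,
  competitors of \<open>bxor v c\<close> correspond exactly to competitors of
  \<open>c\<close>.\<close>

lemma integral_lik_error_coset:
  assumes v: "v \<in> bwords n" and C: "C \<subseteq> bwords n" and c: "c \<in> C"
  shows "(\<integral>z. lik snr (bxor v c) z * of_bool (ml_error_event snr (coset_of C v) (bxor v c) z) \<partial>out_space n)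
    = measure (channel_out snr c)
        {z \<in> space (out_space n). \<exists>x'\<in>C. x' \<noteq> c \<and> lik snr x' z \<ge> lik snr c z}"
proof -
  have cn: "c \<in> bwords n" using c C by auto
  have [measurable]: "lik snr c \<in> borel_measurable (out_space n)" using cn by simp
  have [measurable]: "Measurable.pred (out_space n) (ml_error_event snr C c)"
    using C cn by simp
  have neq: "bxor v d \<noteq> bxor v c \<longleftrightarrow> d \<noteq> c" if "d \<in> C" for d
    using inj_onD[OF inj_on_bxor[OF v], of d c] that C cn by auto
  have flip_event: "ml_error_event snr (coset_of C v) (bxor v c) z = ml_error_event snr C c (flip n v z)" for z
    using neq C lik_bxor[OF v] c unfolding ml_error_event_def coset_of_def
    by (auto simp: subset_iff)
  have "(\<integral>z. lik snr (bxor v c) z * of_bool (ml_error_event snr (coset_of C v) (bxor v c) z) \<partial>out_space n)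
      = (\<integral>z. lik snr c (flip n v z) * of_bool (ml_error_event snr C c (flip n v z)) \<partial>out_space n)"
    by (simp add: flip_event lik_bxor[OF v cn])
  also have "\<dots> = (\<integral>z. lik snr c z * of_bool (ml_error_event snr C c z)
      \<partial>distr (out_space n) (out_space n) (flip n v))"
    by (rule integral_distr[symmetric]) measurable
  also have "\<dots> = measure (channel_out snr c) {z \<in> space (out_space n). ml_error_event snr C c z}"
    unfolding distr_flip by (rule measure_channel_out[symmetric]) (use cn in measurable)
  finally show ?thesis by (simp add: ml_error_event_def)
qed

section \<open>Fano's inequality\<close>

text \<open>The weights need not sum to 1, so the likelihoods at one fixed output can be inserted
  directly. The constant 1 bounds the binary entropy of the error indicator in the usual form of
  Fano's inequality.\<close>

lemma finite_fano:
  fixes p :: "'a \<Rightarrow> real"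
  assumes W: "finite W" and p: "\<And>x. x \<in> W \<Longrightarrow> p x > 0"
  defines "err x \<equiv> \<exists>x'\<in>W. x' \<noteq> x \<and> p x' \<ge> p x"
  shows "(\<Sum>x\<in>W. p x * log 2 ((\<Sum>y\<in>W. p y) / p x)) \<le>
    (\<Sum>x\<in>W. p x * (1 + log 2 (card W) * of_bool (err x)))"
proof (cases "W = {}")
  case False
  define S where "S = (\<Sum>y\<in>W. p y)"
  \<comment> \<open>The reference weights give 1/2 to the strict maximiser of \<open>p\<close>, if
    there is one, and share another 1/2 equally. Coding with them costs 1 bit without an error and
    \<open>1 + log 2 (card W)\<close> bits with one.\<close>
  define r :: "'a \<Rightarrow> real" where "r x = (if err x then 1 / card W else 1) / 2" for x
  have S: "S > 0" unfolding S_def using W False p by (rule sum_pos)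
  have K: "card W > 0" using W False by (simp add: card_gt_0_iff)
  have r: "r x > 0" for x using K by (simp add: r_def)
  \<comment> \<open>Ties count as errors, so two distinct error-free candidates would each have to
    outweigh the other strictly.\<close>
  have "card {x\<in>W. \<not> err x} \<le> 1"
  proof (rule card_le_Suc0_iff_eq[THEN iffD2, simplified One_nat_def[symmetric]])
    show "\<forall>x\<in>{x \<in> W. \<not> err x}. \<forall>y\<in>{x \<in> W. \<not> err x}. x = y"
      unfolding err_def by (auto simp: not_le) (metis less_asym)
  qed (use W in auto)
  then have "(\<Sum>x\<in>W. if \<not> err x then 1 / 2 else 0 :: real) \<le> 1 / 2"
    using W by (simp add: sum.If_cases Int_def)
  moreover have "(\<Sum>x\<in>W. r x) \<le> (\<Sum>x\<in>W. 1 / (2 * card W) + (if \<not> err x then 1 / 2 else 0))"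
    using K by (intro sum_mono) (simp add: r_def)
  moreover have "(\<Sum>x\<in>W. 1 / (2 * real (card W))) = 1 / 2"
    using K by simp
  ultimately have sum_r: "(\<Sum>x\<in>W. r x) \<le> 1"
    by (simp add: sum.distrib)
  have log_r: "log 2 (1 / r x) = 1 + log 2 (card W) * of_bool (err x)" for x
    using K by (simp add: r_def log_mult)
  \<comment> \<open>Gibbs' inequality against the subprobability \<open>r\<close>\<close>
  have "p x * log 2 (S / p x) - p x * log 2 (1 / r x) \<le> (S * r x - p x) / ln 2" if x: "x \<in> W" for x
  proof -
    have px: "p x > 0" using p x by auto
    have "log 2 (S / p x) - log 2 (1 / r x) = ln (S * r x / p x) / ln 2"
      using px S r[of x] by (simp add: log_def ln_div ln_mult diff_divide_distrib add_divide_distrib)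
    also have "\<dots> \<le> (S * r x / p x - 1) / ln 2"
      using px S r[of x] by (intro divide_right_mono ln_le_minus_one) auto
    finally have "p x * (log 2 (S / p x) - log 2 (1 / r x)) \<le> p x * ((S * r x / p x - 1) / ln 2)"
      using px by (intro mult_left_mono) auto
    then show ?thesis using px by (simp add: algebra_simps diff_divide_distrib)
  qed
  then have "(\<Sum>x\<in>W. p x * log 2 (S / p x) - p x * log 2 (1 / r x)) \<le> (\<Sum>x\<in>W. (S * r x - p x) / ln 2)"
    by (rule sum_mono)
  also have "\<dots> = S * ((\<Sum>x\<in>W. r x) - 1) / ln 2"
    by (simp add: sum_divide_distrib[symmetric] sum_subtractf sum_distrib_left[symmetric] S_def[symmetric]
        algebra_simps)
  also have "\<dots> \<le> 0"
    using S sum_r by (simp add: divide_nonpos_pos mult_nonneg_nonpos)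
  finally show ?thesis
    by (simp add: sum_subtractf log_r S_def)
qed simp

section \<open>The equivocation of the coset code\<close>

text \<open>Divided by \<open>2 ^ n\<close>, this is the joint density of message \<open>W\<close>
  and output, or the output density when \<open>W\<close> is the set of all words. Without
  normalisation, \<open>lik snr x z / code_lik snr W z\<close> is the posterior of \<open>x\<close>
  within \<open>W\<close>.\<close>

definition code_lik :: "real \<Rightarrow> bool list set \<Rightarrow> (nat \<Rightarrow> real) \<Rightarrow> real" where
  "code_lik snr W z = (\<Sum>x\<in>W. lik snr x z)"

lemma code_lik_nonneg: "code_lik snr W z \<ge> 0"
  by (auto simp: code_lik_def intro!: sum_nonneg less_imp_le[OF lik_pos])

lemma code_lik_pos: "finite W \<Longrightarrow> W \<noteq> {} \<Longrightarrow> code_lik snr W z > 0"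
  by (auto simp: code_lik_def intro!: sum_pos lik_pos)

lemma borel_measurable_code_lik [simp]:
  "W \<subseteq> bwords n \<Longrightarrow> code_lik snr W \<in> borel_measurable (out_space n)"
  unfolding code_lik_def[abs_def] by (intro borel_measurable_sum) auto

lemma lik_le_code_lik: "finite W \<Longrightarrow> x \<in> W \<Longrightarrow> lik snr x z \<le> code_lik snr W z"
  unfolding code_lik_def by (rule member_le_sum) (auto intro: less_imp_le[OF lik_pos])

lemma code_lik_mono: "V \<subseteq> W \<Longrightarrow> finite W \<Longrightarrow> code_lik snr V z \<le> code_lik snr W z"
  unfolding code_lik_def by (rule sum_mono2) (auto intro: less_imp_le[OF lik_pos])

text \<open>A posterior is at most 1, and more candidates can only lower it. The bounds serve the
  sign of the residual entropy and the domination argument for integrability.\<close>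

lemma log_code_lik_ratio_bounds:
  assumes "finite W" "V \<subseteq> W" "x \<in> V"
  shows "0 \<le> log 2 (code_lik snr V z / lik snr x z)"
    and "log 2 (code_lik snr V z / lik snr x z) \<le> log 2 (code_lik snr W z / lik snr x z)"
proof -
  have "finite V" using assms finite_subset by blast
  note 1 = lik_le_code_lik[OF this assms(3), of snr z] and 2 = code_lik_mono[OF assms(2,1), of snr z]
  show "0 \<le> log 2 (code_lik snr V z / lik snr x z)"
    using 1 lik_pos[of snr x z] by simp
  have "0 < code_lik snr V z / lik snr x z"
    using 1 lik_pos[of snr x z] by simp
  moreover have "code_lik snr V z / lik snr x z \<le> code_lik snr W z / lik snr x z"
    using 2 lik_pos[of snr x z] by (simp add: divide_right_mono)
  ultimately show "log 2 (code_lik snr V z / lik snr x z) \<le> log 2 (code_lik snr W z / lik snr x z)"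
    by simp
qed

text \<open>For a proper subset of the words the logarithm does not split over positions, so the
  integrand is dominated by the one for all words, where it does.\<close>

lemma integrable_lik_log_code_lik:
  assumes snr: "snr > 0" and W: "W \<subseteq> bwords n" and x: "x \<in> W"
  shows "integrable (out_space n) (\<lambda>z. lik snr x z * log 2 (code_lik snr W z / lik snr x z))"
proof (rule Bochner_Integration.integrable_bound)
  have xn: "x \<in> bwords n" using W x by auto
  show "integrable (out_space n) (\<lambda>z. lik snr x z * log 2 (code_lik snr (bwords n) z / lik snr x z))"
    unfolding code_lik_def by (rule integrable_lik_log_posterior[OF snr xn])
  have [measurable]: "lik snr x \<in> borel_measurable (out_space n)"
      "code_lik snr W \<in> borel_measurable (out_space n)"
    using W xn by auto
  show "(\<lambda>z. lik snr x z * log 2 (code_lik snr W z / lik snr x z)) \<in> borel_measurable (out_space n)"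
    by measurable
  show "AE z in out_space n. norm (lik snr x z * log 2 (code_lik snr W z / lik snr x z))
      \<le> norm (lik snr x z * log 2 (code_lik snr (bwords n) z / lik snr x z))"
    using log_code_lik_ratio_bounds[OF finite_bwords W x, of snr] lik_pos[of snr x]
      log_code_lik_ratio_bounds(1)[OF finite_bwords subset_refl xn, of snr]
    by (auto simp: abs_mult intro!: AE_I2 mult_left_mono)
qed

section \<open>The joint law of message, codeword and output, and its entropies\<close>

context binary_linear_code
begin

abbreviation "wt_density snr \<equiv> (\<lambda>(w, x, z). ennreal ((1 / real (card cosets)) *
        (if x \<in> w then 1 / real (card w) else 0) * lik snr x z))"

lemma wt_density_eq:
  "w \<in> cosets \<Longrightarrow> wt_density snr (w, x, z) = ennreal ((if x \<in> w then 1 / 2 ^ n else 0) * lik snr x z)"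
  using coset_weight[of w] by (simp add: mult.commute)

lemma sum_wt_density:
  assumes w: "w \<in> cosets"
  shows "(\<Sum>x\<in>bwords n. wt_density snr (w, x, z)) = ennreal (code_lik snr w z / 2 ^ n)"
proof -
  have "(\<Sum>x\<in>bwords n. wt_density snr (w, x, z)) =
      ennreal (\<Sum>x\<in>bwords n. (if x \<in> w then 1 / 2 ^ n else 0) * lik snr x z)"
    unfolding wt_density_eq[OF w] by (rule sum_ennreal) (auto intro!: divide_nonneg_nonneg less_imp_le[OF lik_pos])
  also have "(\<Sum>x\<in>bwords n. (if x \<in> w then 1 / 2 ^ n else 0) * lik snr x z) =
      (\<Sum>x\<in>w. lik snr x z / 2 ^ n)"
    using coset_in_bwords[OF w] by (intro sum.mono_neutral_cong_right) auto
  finally show ?thesis by (simp add: code_lik_def sum_divide_distrib)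
qed

lemma borel_measurable_wt_density: "wt_density snr \<in> borel_measurable (wt_space n (bwords n) C)"
  unfolding wt_space_def
proof (intro measurable_pair_measure_countable1 countable_finite finite_cosets finite_bwords)
  fix w x assume "x \<in> bwords n"
  then have [measurable]: "lik snr x \<in> borel_measurable (out_space n)" by simp
  show "(\<lambda>z. wt_density snr (w, x, z)) \<in> borel_measurable (out_space n)"
    unfolding prod.case by measurable
qed

text \<open>The codeword is integrated out against an arbitrary test function of message and output.
  Constant 1 gives the total mass; indicators give the densities of \<open>(W,Z)\<close> and of
  \<open>Z\<close>.\<close>

lemma nn_integral_wt_joint:
  assumes g: "g \<in> borel_measurable (count_space cosets \<Otimes>\<^sub>M out_space n)"
  shows "(\<integral>\<^sup>+p. g (fst p, snd (snd p)) \<partial>wt_joint snr n (bwords n) C) =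
    (\<Sum>w\<in>cosets. \<integral>\<^sup>+z. ennreal (code_lik snr w z / 2 ^ n) * g (w, z) \<partial>out_space n)"
proof -
  interpret XT: pair_sigma_finite "count_space (bwords n)" "out_space n"
    by (intro pair_sigma_finite.intro sigma_finite_out_space sigma_finite_measure_count_space)
  note [measurable] = g borel_measurable_wt_density[unfolded wt_space_def]
  \<comment> \<open>Message and codeword range over finite sets, so measurability on the products
    may be checked on slices with both of them fixed.\<close>
  have gw: "(\<lambda>z. g (w, z)) \<in> borel_measurable (out_space n)" if "w \<in> cosets" for w
    using that by (intro measurable_compose[OF measurable_Pair1' g]) simp
  have fw: "(\<lambda>z. wt_density snr (w, x, z)) \<in> borel_measurable (out_space n)"
    if "x \<in> bwords n" for w x
  proof -
    have [measurable]: "lik snr x \<in> borel_measurable (out_space n)" using that by simp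
    show ?thesis unfolding prod.case by measurable
  qed
  have fgw: "(\<lambda>q. wt_density snr (w, q) * g (w, snd q)) \<in> borel_measurable (count_space (bwords n) \<Otimes>\<^sub>M out_space n)"
    if "w \<in> cosets" for w
    using gw[OF that] fw by (intro measurable_pair_measure_countable1 countable_finite finite_bwords) simp_all
  have fg: "(\<lambda>p. wt_density snr p * g (fst p, snd (snd p))) \<in> borel_measurable
      (count_space cosets \<Otimes>\<^sub>M (count_space (bwords n) \<Otimes>\<^sub>M out_space n))"
    using fgw by (intro measurable_pair_measure_countable1[OF countable_finite[OF finite_cosets]])
      (simp only: fst_conv snd_conv)
  have "(\<integral>\<^sup>+p. g (fst p, snd (snd p)) \<partial>wt_joint snr n (bwords n) C) =
      (\<integral>\<^sup>+p. wt_density snr p * g (fst p, snd (snd p)) \<partial>wt_space n (bwords n) C)"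
    unfolding wt_joint_def wt_space_def by (rule nn_integral_density) measurable
  also have "\<dots> = (\<Sum>w\<in>cosets. \<integral>\<^sup>+q. wt_density snr (w, q) * g (w, snd q)
      \<partial>(count_space (bwords n) \<Otimes>\<^sub>M out_space n))"
    unfolding wt_space_def
    by (subst nn_integral_count_space_pair[OF finite_cosets XT.sigma_finite_measure_axioms fg]) simp
  also have "\<dots> = (\<Sum>w\<in>cosets. \<Sum>x\<in>bwords n. \<integral>\<^sup>+z. wt_density snr (w, x, z) * g (w, z) \<partial>out_space n)"
    by (intro sum.cong refl)
      (simp only: nn_integral_count_space_pair[OF finite_bwords sigma_finite_out_space fgw] snd_conv)
  also have "\<dots> = (\<Sum>w\<in>cosets. \<integral>\<^sup>+z. (\<Sum>x\<in>bwords n. wt_density snr (w, x, z) * g (w, z)) \<partial>out_space n)"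
    using fw gw by (intro sum.cong refl nn_integral_sum[symmetric] borel_measurable_times_ennreal)
  also have "\<dots> = (\<Sum>w\<in>cosets. \<integral>\<^sup>+z. ennreal (code_lik snr w z / 2 ^ n) * g (w, z) \<partial>out_space n)"
    by (intro sum.cong refl) (simp only: sum_distrib_right[symmetric] sum_wt_density)
  finally show ?thesis .
qed

lemma sum_code_lik_cosets: "(\<Sum>w\<in>cosets. code_lik snr w z) = code_lik snr (bwords n) z"
  by (simp add: code_lik_def sum_cosets)

lemma measurable_wt_message_output:
  "(\<lambda>p. (fst p, snd (snd p))) \<in> wt_joint snr n (bwords n) C \<rightarrow>\<^sub>M count_space cosets \<Otimes>\<^sub>M out_space n"
  unfolding wt_joint_def wt_space_def by simp

lemma measurable_coset_pair:
  fixes f :: "bool list set \<Rightarrow> (nat \<Rightarrow> real) \<Rightarrow> real"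
  assumes "\<And>w. w \<in> cosets \<Longrightarrow> f w \<in> borel_measurable (out_space n)"
  shows "(\<lambda>(w, z). f w z) \<in> borel_measurable (count_space cosets \<Otimes>\<^sub>M out_space n)"
  using assms by (intro measurable_pair_measure_countable1 countable_finite finite_cosets) simp_all

lemma prob_space_wt_joint: "prob_space (wt_joint snr n (bwords n) C)"
proof
  have "emeasure (wt_joint snr n (bwords n) C) (space (wt_joint snr n (bwords n) C)) =
      (\<integral>\<^sup>+p. 1 \<partial>wt_joint snr n (bwords n) C)" by simp
  also have "\<dots> = (\<Sum>w\<in>cosets. \<integral>\<^sup>+z. ennreal (code_lik snr w z / 2 ^ n) \<partial>out_space n)"
    using nn_integral_wt_joint[of "\<lambda>_. 1" snr] by simp
  also have "\<dots> = (\<Sum>w\<in>cosets. ennreal (\<Sum>x\<in>w. 1 / 2 ^ n))"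
  proof (intro sum.cong refl)
    fix w assume w: "w \<in> cosets"
    have int: "integrable (out_space n) (lik snr x)" "(\<integral>z. lik snr x z \<partial>out_space n) = 1" if "x \<in> w" for x
      using that coset_in_bwords[OF w] by (auto intro: integrable_lik integral_lik)
    have "integrable (out_space n) (\<lambda>z. code_lik snr w z / 2 ^ n)"
      unfolding code_lik_def using int by auto
    then have "(\<integral>\<^sup>+z. ennreal (code_lik snr w z / 2 ^ n) \<partial>out_space n) =
        ennreal (\<integral>z. code_lik snr w z / 2 ^ n \<partial>out_space n)"
      by (rule nn_integral_eq_integral) (simp add: code_lik_nonneg)
    also have "(\<integral>z. code_lik snr w z / 2 ^ n \<partial>out_space n) = (\<Sum>x\<in>w. 1 / 2 ^ n)"
      unfolding code_lik_def using int by simp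
    finally show "(\<integral>\<^sup>+z. ennreal (code_lik snr w z / 2 ^ n) \<partial>out_space n) = ennreal (\<Sum>x\<in>w. 1 / 2 ^ n)" .
  qed
  also have "\<dots> = ennreal (\<Sum>w\<in>cosets. \<Sum>x\<in>w. 1 / 2 ^ n)"
    by (rule sum_ennreal) (simp add: sum_nonneg)
  also have "\<dots> = 1"
    unfolding sum_cosets by (simp add: card_bwords)
  finally show "emeasure (wt_joint snr n (bwords n) C) (space (wt_joint snr n (bwords n) C)) = 1" .
qed

text \<open>This density and that of \<open>distributed_output\<close> are the data from which
  \<open>conditional_entropy_generic_eq\<close> evaluates the equivocation.\<close>

lemma distributed_message_output:
  "distributed (wt_joint snr n (bwords n) C) (count_space cosets \<Otimes>\<^sub>M out_space n)
    (\<lambda>p. (fst p, snd (snd p))) (\<lambda>(w, z). code_lik snr w z / 2 ^ n)"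
  unfolding distributed_def
proof (intro conjI measurable_wt_message_output)
  let ?J = "wt_joint snr n (bwords n) C" and ?P = "count_space cosets \<Otimes>\<^sub>M out_space n"
  have f: "(\<lambda>(w, z). code_lik snr w z / 2 ^ n) \<in> borel_measurable ?P"
    by (intro measurable_coset_pair borel_measurable_divide) (auto dest: coset_in_bwords)
  then show f': "(\<lambda>p. ennreal ((\<lambda>(w, z). code_lik snr w z / 2 ^ n) p)) \<in> borel_measurable ?P"
    by simp
  show "distr ?J ?P (\<lambda>p. (fst p, snd (snd p))) = density ?P (\<lambda>p. ennreal ((\<lambda>(w, z). code_lik snr w z / 2 ^ n) p))"
  proof (rule measure_eqI)
    fix E assume "E \<in> sets (distr ?J ?P (\<lambda>p. (fst p, snd (snd p))))"
    then have E: "E \<in> sets ?P" by simp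
    note [measurable] = E f' measurable_wt_message_output
    have "emeasure (distr ?J ?P (\<lambda>p. (fst p, snd (snd p)))) E =
        (\<integral>\<^sup>+p. indicator E p \<partial>distr ?J ?P (\<lambda>p. (fst p, snd (snd p))))"
      using E by simp
    also have "\<dots> = (\<integral>\<^sup>+p. indicator E (fst p, snd (snd p)) \<partial>?J)"
      using E by (intro nn_integral_distr measurable_wt_message_output) simp
    also have "\<dots> = (\<Sum>w\<in>cosets. \<integral>\<^sup>+z. ennreal (code_lik snr w z / 2 ^ n) * indicator E (w, z) \<partial>out_space n)"
      using E by (intro nn_integral_wt_joint) simp
    also have "\<dots> = (\<integral>\<^sup>+p. ennreal ((\<lambda>(w, z). code_lik snr w z / 2 ^ n) p) * indicator E p \<partial>?P)"
      by (subst nn_integral_count_space_pair[OF finite_cosets sigma_finite_out_space]) auto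
    also have "\<dots> = emeasure (density ?P (\<lambda>p. ennreal ((\<lambda>(w, z). code_lik snr w z / 2 ^ n) p))) E"
      by (rule emeasure_density[symmetric]) (use E f' in auto)
    finally show "emeasure (distr ?J ?P (\<lambda>p. (fst p, snd (snd p)))) E =
      emeasure (density ?P (\<lambda>p. ennreal ((\<lambda>(w, z). code_lik snr w z / 2 ^ n) p))) E" .
  qed simp
qed

lemma distributed_output:
  "distributed (wt_joint snr n (bwords n) C) (out_space n) (\<lambda>(w, x, z). z)
    (\<lambda>z. code_lik snr (bwords n) z / 2 ^ n)"
  unfolding distributed_def
proof (intro conjI)
  let ?J = "wt_joint snr n (bwords n) C"
  have out: "(\<lambda>(w, x, z). z) = (\<lambda>p :: bool list set \<times> bool list \<times> (nat \<Rightarrow> real). snd (snd p))" by auto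
  show out_meas: "(\<lambda>(w, x, z). z) \<in> ?J \<rightarrow>\<^sub>M out_space n"
    unfolding out wt_joint_def wt_space_def by simp
  show f: "(\<lambda>z. ennreal (code_lik snr (bwords n) z / 2 ^ n)) \<in> borel_measurable (out_space n)"
    by (intro measurable_compose[OF _ measurable_ennreal] borel_measurable_divide) auto
  show "distr ?J (out_space n) (\<lambda>(w, x, z). z) = density (out_space n) (\<lambda>z. ennreal (code_lik snr (bwords n) z / 2 ^ n))"
  proof (rule measure_eqI)
    fix E assume "E \<in> sets (distr ?J (out_space n) (\<lambda>(w, x, z). z))"
    then have E [measurable]: "E \<in> sets (out_space n)" by simp
    have "emeasure (distr ?J (out_space n) (\<lambda>(w, x, z). z)) E =
        (\<integral>\<^sup>+z. indicator E z \<partial>distr ?J (out_space n) (\<lambda>(w, x, z). z))"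
      using E by simp
    also have "\<dots> = (\<integral>\<^sup>+p. indicator E (snd (snd p)) \<partial>?J)"
      using out_meas E unfolding out by (intro nn_integral_distr) simp_all
    also have "\<dots> = (\<Sum>w\<in>cosets. \<integral>\<^sup>+z. ennreal (code_lik snr w z / 2 ^ n) * indicator E z \<partial>out_space n)"
      using nn_integral_wt_joint[of "\<lambda>p. indicator E (snd p)" snr] by simp
    also have "\<dots> = (\<integral>\<^sup>+z. (\<Sum>w\<in>cosets. ennreal (code_lik snr w z / 2 ^ n) * indicator E z) \<partial>out_space n)"
      using E coset_in_bwords
      by (intro nn_integral_sum[symmetric] borel_measurable_times_ennreal
          measurable_compose[OF _ measurable_ennreal] borel_measurable_divide) auto
    also have "\<dots> = (\<integral>\<^sup>+z. ennreal (code_lik snr (bwords n) z / 2 ^ n) * indicator E z \<partial>out_space n)"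
      by (simp add: sum_distrib_right[symmetric] sum_ennreal code_lik_nonneg sum_divide_distrib[symmetric]
          sum_code_lik_cosets)
    also have "\<dots> = emeasure (density (out_space n) (\<lambda>z. ennreal (code_lik snr (bwords n) z / 2 ^ n))) E"
      by (rule emeasure_density[symmetric]) (use E f in auto)
    finally show "emeasure (distr ?J (out_space n) (\<lambda>(w, x, z). z)) E =
      emeasure (density (out_space n) (\<lambda>z. ennreal (code_lik snr (bwords n) z / 2 ^ n))) E" .
  qed simp
qed

text \<open>The conditional entropy of the codeword given message and eavesdropper output.\<close>

definition residual_entropy :: "real \<Rightarrow> real" where
  "residual_entropy snr = (\<Sum>w\<in>cosets. \<Sum>x\<in>w.
     \<integral>z. lik snr x z * log 2 (code_lik snr w z / lik snr x z) \<partial>out_space n) / 2 ^ n"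

text \<open>The chain rule \<open>H(W|Z) = H(X|Z) - H(X|W,Z)\<close>.\<close>

lemma equivocation_eq:
  assumes snr: "snr > 0"
  shows "equivocation snr n (bwords n) C = real n * (1 - C_BIAWGN snr) - residual_entropy snr"
proof -
  let ?S = "code_lik snr (bwords n)"
  interpret prob_space "wt_joint snr n (bwords n) C" by (rule prob_space_wt_joint)
  interpret information_space "wt_joint snr n (bwords n) C" 2 by standard simp
  have out: "(\<lambda>p. (fst p, (\<lambda>(w, x, z). z) p)) =
      (\<lambda>p :: bool list set \<times> bool list \<times> (nat \<Rightarrow> real). (fst p, snd (snd p)))" by auto
  \<comment> \<open>Inserting \<open>lik snr x z\<close> into the logarithm splits the integrand
    \<open>g\<close> of \<open>H(W|Z)\<close>, up to sign, over the words of the coset. The two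
    parts of \<open>T\<close> belong to \<open>H(X|Z)\<close> and \<open>H(X|W,Z)\<close>, and each
    is integrable by itself.\<close>
  define T where "T w x z = lik snr x z * log 2 (?S z / lik snr x z) / 2 ^ n -
      lik snr x z * log 2 (code_lik snr w z / lik snr x z) / 2 ^ n" for w x z
  define g where "g w z = code_lik snr w z / 2 ^ n * log 2 (code_lik snr w z / 2 ^ n / (?S z / 2 ^ n))" for w z
  have g_eq: "g w z = - (\<Sum>x\<in>w. T w x z)" if w: "w \<in> cosets" for w z
  proof (cases "w = {}")
    case False
    have pos: "code_lik snr w z > 0" "?S z > 0"
      using False finite_coset[OF w] coset_in_bwords[OF w] by (auto intro!: code_lik_pos)
    have "T w x z = - (lik snr x z / 2 ^ n * log 2 (code_lik snr w z / ?S z))" for x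
      using pos lik_pos[of snr x z] by (simp add: T_def log_divide algebra_simps diff_divide_distrib add_divide_distrib)
    then show ?thesis
      by (simp add: g_def sum_negf sum_distrib_right[symmetric] sum_divide_distrib[symmetric] code_lik_def[of snr w])
  qed (simp add: g_def code_lik_def)
  have int: "integrable (out_space n) (\<lambda>z. lik snr x z * log 2 (?S z / lik snr x z) / 2 ^ n)"
      "integrable (out_space n) (\<lambda>z. lik snr x z * log 2 (code_lik snr w z / lik snr x z) / 2 ^ n)"
    if "w \<in> cosets" "x \<in> w" for w x
    using that integrable_lik_log_code_lik[OF snr] coset_in_bwords[OF that(1)] by auto
  have int_T: "integrable (out_space n) (T w x)" if "w \<in> cosets" "x \<in> w" for w x
    unfolding T_def[abs_def] using int[OF that] by (rule Bochner_Integration.integrable_diff)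
  have integral_T: "(\<integral>z. T w x z \<partial>out_space n) = real n * (1 - C_BIAWGN snr) / 2 ^ n -
      (\<integral>z. lik snr x z * log 2 (code_lik snr w z / lik snr x z) \<partial>out_space n) / 2 ^ n"
    if "w \<in> cosets" "x \<in> w" for w x
  proof -
    have "x \<in> bwords n" using that coset_in_bwords by auto
    then have "(\<integral>z. lik snr x z * log 2 (?S z / lik snr x z) \<partial>out_space n) = real n * (1 - C_BIAWGN snr)"
      unfolding code_lik_def by (rule integral_lik_log_posterior[OF snr])
    then show ?thesis
      unfolding T_def using Bochner_Integration.integral_diff[OF int[OF that]] by simp
  qed
  have int_g: "integrable (out_space n) (g w)" if "w \<in> cosets" for w
    unfolding g_eq[OF that, THEN ext] using int_T[OF that] by simp
  have "equivocation snr n (bwords n) C =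
      - (\<integral>(w, z). (\<lambda>(w, z). code_lik snr w z / 2 ^ n) (w, z) *
          log 2 ((\<lambda>(w, z). code_lik snr w z / 2 ^ n) (w, z) / (?S z / 2 ^ n))
        \<partial>(count_space cosets \<Otimes>\<^sub>M out_space n))"
    unfolding equivocation_def
    using distributed_message_output[of snr]
    by (intro conditional_entropy_generic_eq sigma_finite_out_space distributed_output
        sigma_finite_measure_count_space_finite finite_cosets) (simp_all add: out code_lik_nonneg)
  also have "\<dots> = - (\<integral>p. (\<lambda>(w, z). g w z) p \<partial>(count_space cosets \<Otimes>\<^sub>M out_space n))"
    by (simp only: g_def prod.case)
  also have "\<dots> = - (\<Sum>w\<in>cosets. \<integral>z. g w z \<partial>out_space n)"
    using int_g by (subst integral_count_space_pair[OF finite_cosets sigma_finite_out_space]) simp_all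
  also have "\<dots> = - (\<Sum>w\<in>cosets. \<integral>z. - (\<Sum>x\<in>w. T w x z) \<partial>out_space n)"
    by (simp only: g_eq cong: sum.cong)
  also have "\<dots> = (\<Sum>w\<in>cosets. \<Sum>x\<in>w. \<integral>z. T w x z \<partial>out_space n)"
    using int_T by (simp add: sum_negf cong: sum.cong)
  also have "\<dots> = (\<Sum>w\<in>cosets. \<Sum>x\<in>w. real n * (1 - C_BIAWGN snr) / 2 ^ n) - residual_entropy snr"
    by (simp add: integral_T residual_entropy_def sum_subtractf sum_divide_distrib cong: sum.cong)
  also have "(\<Sum>w\<in>cosets. \<Sum>x\<in>w. real n * (1 - C_BIAWGN snr) / 2 ^ n) = real n * (1 - C_BIAWGN snr)"
    unfolding sum_cosets by (simp add: card_bwords)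
  finally show ?thesis .
qed

text \<open>Posteriors of a discrete codeword never exceed 1. This caps the equivocation rate at
  \<open>1 - C_BIAWGN snr\<close> for every block length.\<close>

lemma residual_entropy_nonneg: "0 \<le> residual_entropy snr"
  unfolding residual_entropy_def
  using log_code_lik_ratio_bounds(1)[OF finite_bwords coset_in_bwords, of _ _ snr]
  by (intro divide_nonneg_nonneg sum_nonneg Bochner_Integration.integral_nonneg mult_nonneg_nonneg)
    (auto intro: less_imp_le[OF lik_pos])

text \<open>All cosets are equally hard to decode. The factor \<open>card C\<close> undoes the
  averaging over codewords in \<open>ml_word_error\<close>.\<close>

lemma sum_lik_error_coset:
  assumes "w \<in> cosets"
  shows "(\<Sum>x\<in>w. \<integral>z. lik snr x z * of_bool (ml_error_event snr w x z) \<partial>out_space n) =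
    card C * ml_word_error n C snr"
proof -
  obtain v where v: "v \<in> bwords n" "w = coset_of C v"
    using assms by (auto simp: messages_def)
  have "inj_on (bxor v) C" using inj_on_bxor[OF v(1)] code_subset inj_on_subset by blast
  then have "(\<Sum>x\<in>w. \<integral>z. lik snr x z * of_bool (ml_error_event snr w x z) \<partial>out_space n) =
      (\<Sum>c\<in>C. \<integral>z. lik snr (bxor v c) z * of_bool (ml_error_event snr w (bxor v c) z) \<partial>out_space n)"
    unfolding v(2) by (subst (1) coset_of_def) (simp add: sum.reindex)
  then show ?thesis
    using card_code_pos unfolding v(2)
    by (simp add: integral_lik_error_coset[OF v(1) code_subset] ml_word_error_def)
qed

text \<open>Fano's inequality is applied at each \<open>z\<close> and then integrated. Every
  likelihood has mass 1, so a coset contributes \<open>card C\<close> times the bound, and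
  \<open>card_cosets\<close> cancels the division by \<open>2 ^ n\<close>.\<close>

lemma residual_entropy_le:
  assumes snr: "snr > 0"
  shows "residual_entropy snr \<le> 1 + log 2 (card C) * ml_word_error n C snr"
proof -
  have coset_bound: "(\<Sum>x\<in>w. \<integral>z. lik snr x z * log 2 (code_lik snr w z / lik snr x z) \<partial>out_space n) \<le>
      real (card C) * (1 + log 2 (card C) * ml_word_error n C snr)" if w: "w \<in> cosets" for w
  proof -
    have wn: "w \<subseteq> bwords n" by (rule coset_in_bwords[OF w])
    let ?e = "\<lambda>x z. lik snr x z * of_bool (ml_error_event snr w x z)"
    have int_e: "integrable (out_space n) (?e x)" if "x \<in> w" for x
    proof (rule Bochner_Integration.integrable_bound[OF integrable_lik[of x n snr]])
      show "x \<in> bwords n" using that wn by auto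
      have [measurable]: "lik snr x \<in> borel_measurable (out_space n)"
          "Measurable.pred (out_space n) (ml_error_event snr w x)"
        using that wn by (auto intro!: measurable_ml_error_event)
      show "?e x \<in> borel_measurable (out_space n)" by measurable
    qed (auto intro!: AE_I2)
    have int_l: "integrable (out_space n) (lik snr x)" if "x \<in> w" for x
      using that wn by (auto intro: integrable_lik)
    have "(\<Sum>x\<in>w. \<integral>z. lik snr x z * log 2 (code_lik snr w z / lik snr x z) \<partial>out_space n) =
        (\<integral>z. (\<Sum>x\<in>w. lik snr x z * log 2 (code_lik snr w z / lik snr x z)) \<partial>out_space n)"
      using integrable_lik_log_code_lik[OF snr wn] by simp
    also have "\<dots> \<le> (\<integral>z. (\<Sum>x\<in>w. lik snr x z + log 2 (card C) * ?e x z) \<partial>out_space n)"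
    proof (rule integral_mono)
      show "integrable (out_space n) (\<lambda>z. \<Sum>x\<in>w. lik snr x z * log 2 (code_lik snr w z / lik snr x z))"
        using integrable_lik_log_code_lik[OF snr wn] by simp
      show "integrable (out_space n) (\<lambda>z. \<Sum>x\<in>w. lik snr x z + log 2 (card C) * ?e x z)"
        using int_e int_l by (intro Bochner_Integration.integrable_sum Bochner_Integration.integrable_add
            integrable_mult_right) auto
      show "(\<Sum>x\<in>w. lik snr x z * log 2 (code_lik snr w z / lik snr x z)) \<le>
          (\<Sum>x\<in>w. lik snr x z + log 2 (card C) * ?e x z)" for z
        using finite_fano[OF finite_coset[OF w], of "\<lambda>x. lik snr x z"] lik_pos
        unfolding code_lik_def ml_error_event_def card_coset[OF w] by (simp add: algebra_simps)
    qed
    also have "\<dots> = (\<Sum>x\<in>w. (\<integral>z. lik snr x z \<partial>out_space n) + log 2 (card C) * (\<integral>z. ?e x z \<partial>out_space n))"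
      using int_e int_l
      by (subst Bochner_Integration.integral_sum) (auto intro!: sum.cong simp del: of_bool_eq)
    also have "\<dots> = real (card C) + log 2 (card C) * (\<Sum>x\<in>w. \<integral>z. ?e x z \<partial>out_space n)"
      using wn by (simp add: sum.distrib sum_distrib_left[symmetric] card_coset[OF w] integral_lik subset_iff cong: sum.cong)
    finally show ?thesis
      by (simp add: sum_lik_error_coset[OF w] algebra_simps)
  qed
  have "residual_entropy snr \<le> (\<Sum>w\<in>cosets. real (card C) * (1 + log 2 (card C) * ml_word_error n C snr)) / 2 ^ n"
    unfolding residual_entropy_def by (intro divide_right_mono sum_mono coset_bound) auto
  also have "\<dots> = real (card cosets * card C) / 2 ^ n * (1 + log 2 (card C) * ml_word_error n C snr)"
    by simp
  also have "\<dots> = 1 + log 2 (card C) * ml_word_error n C snr"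
    unfolding card_cosets by simp
  finally show ?thesis .
qed

end

section \<open>Passage to the limit along the code sequence\<close>

theorem theorem1:
  fixes snr snrs R1 :: real and L :: "nat \<Rightarrow> nat" and C1 :: "nat \<Rightarrow> bool list set"
  assumes "snr > 0"
    and "good_code_seq L C1 R1"
    and "snr_threshold L C1 snrs"
    and "snr \<ge> snrs"
  shows "nested_achieves snr L (\<lambda>m. bwords (L m)) C1 (1 - R1) (1 - C_BIAWGN snr)"
proof -
  have mono: "strict_mono L" and R1: "R1 > 0"
    and code: "\<And>m. binary_linear_code (L m) (C1 m)"
    and dim: "\<And>m. \<exists>k. card (C1 m) = 2 ^ k \<and> real k / real (L m) = R1"
    using assms(2) by (auto simp: good_code_seq_def linear_code_seq_def binary_linear_code_def)
  \<comment> \<open>At length 0 the quotient defining the rate would be 0 by the convention for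
    division, contrary to \<open>R1 > 0\<close>.\<close>
  have L_pos: "L m > 0" for m
    using dim[of m] R1 by (cases "L m") auto
  have log_card: "log 2 (card (C1 m)) = real (L m) * R1" for m
    using dim[of m] L_pos[of m] by (auto simp: log_nat_power)
  have rate: "log 2 (real (card (messages (bwords (L m)) (C1 m)))) / real (L m) = 1 - R1" for m
  proof -
    interpret binary_linear_code "L m" "C1 m" by (rule code)
    have "real (card cosets) * real (card (C1 m)) = 2 ^ L m"
      using card_cosets by (metis of_nat_mult of_nat_numeral of_nat_power)
    moreover have "card cosets > 0"
      using card_cosets by (metis mult_is_0 neq0_conv power_not_zero zero_neq_numeral)
    ultimately have "log 2 (card cosets) + log 2 (card (C1 m)) = real (L m)"
      using card_code_pos by (simp flip: log_mult_pos add: log_nat_power)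
    then have "log 2 (card cosets) = real (L m) * (1 - R1)"
      unfolding log_card by (simp add: algebra_simps)
    then show ?thesis using L_pos[of m] by simp
  qed
  define err where "err m = ml_word_error (L m) (C1 m) snr" for m
  define eq where "eq m = equivocation snr (L m) (bwords (L m)) (C1 m) / real (L m)" for m
  \<comment> \<open>The threshold is invoked at the eavesdropper's own SNR, where the codeword must
    be resolvable once the message is known.\<close>
  have err: "err \<longlonglongrightarrow> 0"
    using assms(1,3,4) unfolding snr_threshold_def err_def[abs_def] by blast
  have upper: "eq m \<le> 1 - C_BIAWGN snr" and lower: "1 - C_BIAWGN snr - (1 / real (L m) + R1 * err m) \<le> eq m" for m
  proof -
    interpret binary_linear_code "L m" "C1 m" by (rule code)
    have eq: "eq m = 1 - C_BIAWGN snr - residual_entropy snr / real (L m)"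
      using L_pos[of m] by (simp add: eq_def equivocation_eq[OF assms(1)] diff_divide_distrib)
    show "eq m \<le> 1 - C_BIAWGN snr"
      unfolding eq using residual_entropy_nonneg by simp
    \<comment> \<open>The Fano factor \<open>log 2 (card C)\<close> grows only linearly in the
      length, so after division a vanishing word error suffices, with no rate of decay.\<close>
    have "residual_entropy snr / real (L m) \<le> (1 + real (L m) * R1 * err m) / real (L m)"
      using residual_entropy_le[OF assms(1)] unfolding log_card err_def by (rule divide_right_mono) simp
    also have "\<dots> = 1 / real (L m) + R1 * err m"
      using L_pos[of m] by (simp add: add_divide_distrib)
    finally show "1 - C_BIAWGN snr - (1 / real (L m) + R1 * err m) \<le> eq m"
      unfolding eq by simp
  qed
  \<comment> \<open>Strictly increasing block lengths make this a subsequence of the reciprocals of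
    the naturals.\<close>
  have "(\<lambda>m. 1 / real (L m)) \<longlonglongrightarrow> 0"
    using LIMSEQ_subseq_LIMSEQ[OF lim_1_over_n mono] by (simp add: o_def)
  then have "(\<lambda>m. 1 - C_BIAWGN snr - (1 / real (L m) + R1 * err m)) \<longlonglongrightarrow> 1 - C_BIAWGN snr - (0 + R1 * 0)"
    by (intro tendsto_intros err)
  then have "(\<lambda>m. 1 - C_BIAWGN snr - (1 / real (L m) + R1 * err m)) \<longlonglongrightarrow> 1 - C_BIAWGN snr"
    by simp
  then have lim: "eq \<longlonglongrightarrow> 1 - C_BIAWGN snr"
    by (rule tendsto_sandwich[rotated 2, OF _ tendsto_const]) (use lower upper in auto)
  have "(\<lambda>m. legit_error (bwords (L m)) (C1 m)) \<longlonglongrightarrow> 0"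
    using binary_linear_code.legit_error_zero[OF code] by simp
  then show ?thesis
    using rate convergentI[OF lim] limI[OF lim] by (simp add: nested_achieves_def flip: eq_def)
qed

end
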